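(* Let $V(\mathbf 0)$ be the Voronoi cell at the origin of the lattice $A_n$. For every integer $k$ with $2\le k\le n-1$, every $k$-dimensional face of $V(\mathbf 0)$ is a hyper-rhombus.
   Context: Let $\mathbf 1=(1,\dots,1)^T\in\mathbb R^{n+1}$ and $H=\{x\in\mathbb R^{n+1}:x\cdot\mathbf 1=0\}$. The lattice $A_n$ is $\mathbb Z^{n+1}\cap H$. Its Voronoi cell at the origin, taken inside $H$, is $V(\mathbf 0)=\{x\in H:\|x\|\le\|x-q\|\text{ for all }q\in A_n\}$, an $n$-dimensional convex polytope. An $m$-dimensional hyper-rhombus is defined recursively: for $m=2$ it is a rhombus; for $m\ge3$ it is a parallelepiped all of whose $(m-1)$-dimensional faces are congruent $(m-1)$-dimensional hyper-rhombi. Congruent means related by an isometry. *)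

theory Defs
  imports "HOL-Analysis.Analysis"
begin

text \<open>The coordinate space is \<^typ>\<open>real ^ 'd\<close> with \<open>CARD('d) = n + 1\<close>; the numeral \<open>1\<close> of this
  type is the all-ones vector.\<close>

definition sum_zero_hyperplane :: "(real ^ 'd) set" where
  "sum_zero_hyperplane = {x. x \<bullet> 1 = 0}"

definition lattice_A :: "(real ^ 'd) set" where
  "lattice_A = {x. \<forall>i. x $ i \<in> \<int>} \<inter> sum_zero_hyperplane"

definition voronoi_cell_A :: "(real ^ 'd) set" where
  "voronoi_cell_A = {x \<in> sum_zero_hyperplane. \<forall>q \<in> lattice_A. norm x \<le> norm (x - q)}"

definition parallelepiped :: "'a::euclidean_space \<Rightarrow> 'a set \<Rightarrow> 'a set" where
  "parallelepiped a B = {a + (\<Sum>b\<in>B. t b *\<^sub>R b) | t. \<forall>b\<in>B. 0 \<le> t b \<and> t b \<le> 1}"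

definition is_parallelepiped :: "nat \<Rightarrow> 'a::euclidean_space set \<Rightarrow> bool" where
  "is_parallelepiped m P \<longleftrightarrow>
     (\<exists>a B. finite B \<and> independent B \<and> card B = m \<and> P = parallelepiped a B)"

definition is_rhombus :: "'a::euclidean_space set \<Rightarrow> bool" where
  "is_rhombus P \<longleftrightarrow>
     (\<exists>a u v. u \<noteq> v \<and> independent {u, v} \<and> norm u = norm v \<and> P = parallelepiped a {u, v})"

text \<open>A distance-preserving self-map of a Euclidean space is automatically bijective.\<close>

definition congruent_sets :: "'a::euclidean_space set \<Rightarrow> 'a set \<Rightarrow> bool" where
  "congruent_sets S T \<longleftrightarrow> (\<exists>f :: 'a \<Rightarrow> 'a. (\<forall>x y. dist (f x) (f y) = dist x y) \<and> f ` S = T)"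

inductive hyper_rhombus :: "nat \<Rightarrow> 'a::euclidean_space set \<Rightarrow> bool" where
  rhombus: "is_rhombus P \<Longrightarrow> hyper_rhombus 2 P"
| step: "\<lbrakk>m \<ge> 3; is_parallelepiped m P;
    \<And>F. \<lbrakk>F face_of P; aff_dim F = int m - 1\<rbrakk> \<Longrightarrow> hyper_rhombus (m - 1) F;
    \<And>F G. \<lbrakk>F face_of P; aff_dim F = int m - 1; G face_of P; aff_dim G = int m - 1\<rbrakk>
      \<Longrightarrow> congruent_sets F G\<rbrakk>
   \<Longrightarrow> hyper_rhombus m P"

end

theory Submission
  imports Defs
begin

text \<open>
  \<open>V(0)\<close> is the image of the unit cube under the orthogonal projection \<open>\<pi>\<close> onto the hyperplane
  orthogonal to \<open>1\<close>. The preimage in the cube of a face of \<open>V(0)\<close> is a face of the cube, hence a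
  smaller cube, so a face of dimension at most \<open>n - 1\<close> is a parallelepiped whose edges are
  distinct vectors \<open>\<pi>(e\<^sub>i)\<close>. All these vectors have the same length and the same pairwise inner products,
  a property inherited by every facet of the parallelepiped; two facets are exchanged, up to a
  translation, by the reflection that swaps the two edge vectors they omit.
\<close>

section \<open>Parallelepipeds\<close>

lemma parallelepiped_mono:
  assumes "finite B" "B' \<subseteq> B"
  shows "parallelepiped a B' \<subseteq> parallelepiped a B"
proof
  fix x assume "x \<in> parallelepiped a B'"
  then obtain t where t: "x = a + (\<Sum>b\<in>B'. t b *\<^sub>R b)" "\<forall>b\<in>B'. 0 \<le> t b \<and> t b \<le> 1"
    unfolding parallelepiped_def by auto
  define s where "s b = (if b \<in> B' then t b else 0)" for b
  have "(\<Sum>b\<in>B'. t b *\<^sub>R b) = (\<Sum>b\<in>B. s b *\<^sub>R b)"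
    using assms by (intro sum.mono_neutral_cong_left) (auto simp: s_def)
  moreover have "\<forall>b\<in>B. 0 \<le> s b \<and> s b \<le> 1"
    using t by (auto simp: s_def)
  ultimately show "x \<in> parallelepiped a B"
    using t unfolding parallelepiped_def by auto
qed

text \<open>Injectivity on \<open>B\<close> keeps the edges apart: edges form a set, so two edges
  with the same image would merge into one, and the sum of their coefficients would no longer fit in
  [0,1].\<close>

lemma linear_image_parallelepiped:
  assumes "linear f" "inj_on f B"
  shows "f ` parallelepiped a B = parallelepiped (f a) (f ` B)"
proof
  interpret linear f by fact
  show "f ` parallelepiped a B \<subseteq> parallelepiped (f a) (f ` B)"
  proof clarify
    fix x assume "x \<in> parallelepiped a B"
    then obtain t where t: "x = a + (\<Sum>b\<in>B. t b *\<^sub>R b)" "\<forall>b\<in>B. 0 \<le> t b \<and> t b \<le> 1"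
      unfolding parallelepiped_def by auto
    define s where "s = t \<circ> inv_into B f"
    have "f x = f a + (\<Sum>b\<in>f ` B. s b *\<^sub>R b)"
      using assms t by (simp add: add sum scale sum.reindex s_def)
    moreover have "\<forall>b\<in>f ` B. 0 \<le> s b \<and> s b \<le> 1"
      using assms t by (auto simp: s_def)
    ultimately show "f x \<in> parallelepiped (f a) (f ` B)"
      unfolding parallelepiped_def by auto
  qed
  show "parallelepiped (f a) (f ` B) \<subseteq> f ` parallelepiped a B"
  proof
    fix y assume "y \<in> parallelepiped (f a) (f ` B)"
    then obtain t where t: "y = f a + (\<Sum>b\<in>f ` B. t b *\<^sub>R b)" "\<forall>b\<in>f ` B. 0 \<le> t b \<and> t b \<le> 1"
      unfolding parallelepiped_def by auto
    have "y = f (a + (\<Sum>b\<in>B. t (f b) *\<^sub>R b))"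
      using assms t by (simp add: add sum scale sum.reindex)
    moreover have "a + (\<Sum>b\<in>B. t (f b) *\<^sub>R b) \<in> parallelepiped a B"
      unfolding parallelepiped_def using t(2) by (auto intro!: exI[of _ "\<lambda>b. t (f b)"])
    ultimately show "y \<in> f ` parallelepiped a B"
      by blast
  qed
qed

lemma translation_parallelepiped: "(+) c ` parallelepiped a B = parallelepiped (c + a) B"
  unfolding parallelepiped_def by (auto simp: image_iff add.assoc)

text \<open>Based at 0, the parallelepiped lies between \<open>B\<close> and \<open>span B\<close>
  and contains 0, so its affine dimension is the linear one; translation changes nothing.\<close>

lemma aff_dim_parallelepiped:
  assumes "finite B" "independent B"
  shows "aff_dim (parallelepiped a B) = int (card B)"
proof -
  let ?Q = "parallelepiped 0 B"
  have B: "B \<subseteq> ?Q"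
  proof
    fix c assume "c \<in> B"
    then have "c = 0 + (\<Sum>b\<in>B. (if b = c then 1 else 0) *\<^sub>R b)"
      using assms by (simp add: if_distrib[of "\<lambda>t. t *\<^sub>R _"] cong: if_cong)
    then show "c \<in> ?Q"
      unfolding parallelepiped_def
      by (intro CollectI exI[of _ "\<lambda>b. if b = c then 1 else 0"]) auto
  qed
  have Q: "?Q \<subseteq> span B"
    unfolding parallelepiped_def by (auto intro!: span_sum span_scale intro: span_base)
  have "0 \<in> ?Q"
    unfolding parallelepiped_def by (auto intro!: exI[of _ "\<lambda>_. 0"])
  then have "aff_dim ?Q = int (dim ?Q)"
    by (intro aff_dim_zero hull_inc)
  also have "dim ?Q = card B"
    using B Q assms(2) by (rule dim_unique) simp
  finally show ?thesis
    using translation_parallelepiped[of a 0 B] aff_dim_translation_eq[of a ?Q] by simp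
qed

text \<open>A relative interior point \<open>x\<close> of \<open>F\<close> determines the face:
  coordinates of \<open>x\<close> strictly inside (0,1) vary freely over \<open>F\<close>, while
  those equal to 0 or 1 are frozen.\<close>

lemma face_of_parallelepiped:
  assumes "finite B" "independent B" "F face_of parallelepiped a B" "F \<noteq> {}"
  shows "\<exists>a' B'. B' \<subseteq> B \<and> F = parallelepiped a' B'"
proof -
  have "convex F"
    using assms(3) by (rule face_of_imp_convex)
  then obtain x where xri: "x \<in> rel_interior F"
    using assms(4) rel_interior_eq_empty by blast
  then have xF: "x \<in> F"
    using rel_interior_subset by blast
  have FP: "F \<subseteq> parallelepiped a B"
    using assms(3) by (rule face_of_imp_subset)
  obtain t where t: "x = a + (\<Sum>b\<in>B. t b *\<^sub>R b)" "\<forall>b\<in>B. 0 \<le> t b \<and> t b \<le> 1"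
    using xF FP unfolding parallelepiped_def by auto
  define B' where "B' = {b \<in> B. 0 < t b \<and> t b < 1}"
  define a' where "a' = a + (\<Sum>b\<in>B - B'. t b *\<^sub>R b)"
  have B': "B' \<subseteq> B" "finite B'"
    using assms(1) by (auto simp: B'_def)
  have split: "(\<Sum>b\<in>B. s b *\<^sub>R b) = (\<Sum>b\<in>B - B'. s b *\<^sub>R b) + (\<Sum>b\<in>B'. s b *\<^sub>R b)" for s
    using sum.subset_diff[OF B'(1) assms(1)] .
  have "F \<subseteq> parallelepiped a' B'"
  proof
    fix y assume "y \<in> F"
    \<comment> \<open>The segment from \<open>y\<close> to \<open>x\<close> can be prolonged beyond
      \<open>x\<close> inside \<open>F\<close>. At a coordinate where \<open>x\<close> has 0 or 1,
      the prolongation leaves [0,1] unless \<open>y\<close> agrees with \<open>x\<close>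
      there.\<close>
    then obtain e where e: "e > 1" "(1 - e) *\<^sub>R y + e *\<^sub>R x \<in> F"
      using convex_rel_interior_iff[OF \<open>convex F\<close> assms(4)] xri by blast
    obtain s where s: "y = a + (\<Sum>b\<in>B. s b *\<^sub>R b)" "\<forall>b\<in>B. 0 \<le> s b \<and> s b \<le> 1"
      using \<open>y \<in> F\<close> FP unfolding parallelepiped_def by auto
    obtain r where r: "(1 - e) *\<^sub>R y + e *\<^sub>R x = a + (\<Sum>b\<in>B. r b *\<^sub>R b)"
        "\<forall>b\<in>B. 0 \<le> r b \<and> r b \<le> 1"
      using e FP unfolding parallelepiped_def by auto
    have "(1 - e) *\<^sub>R y + e *\<^sub>R x = a + (\<Sum>b\<in>B. ((1 - e) * s b + e * t b) *\<^sub>R b)"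
      unfolding s(1) t(1)
      by (simp add: algebra_simps sum.distrib scaleR_sum_right sum_subtractf)
    then have "(\<Sum>b\<in>B. (((1 - e) * s b + e * t b) - r b) *\<^sub>R b) = 0"
      using r(1) by (simp add: scaleR_diff_left sum_subtractf)
    then have r_eq: "\<forall>b\<in>B. r b = (1 - e) * s b + e * t b"
      using independentD[OF assms(2,1) subset_refl] by fastforce
    have "s b = t b" if b: "b \<in> B - B'" for b
    proof -
      have "0 \<le> t b" "t b \<le> 1" "\<not> (0 < t b \<and> t b < 1)" and sb: "0 \<le> s b" "s b \<le> 1"
        using b t(2) s(2) by (simp_all add: B'_def)
      then consider "t b = 0" | "t b = 1"
        by linarith
      then show ?thesis
      proof cases
        case 1
        then have "0 \<le> (1 - e) * s b"
          using r(2) r_eq b by force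
        then show ?thesis
          using 1 e(1) sb by (simp add: zero_le_mult_iff)
      next
        case 2
        then have "(1 - e) * s b + e \<le> 1"
          using r(2) r_eq b by force
        then have "(e - 1) * (1 - s b) \<le> 0"
          by (simp add: algebra_simps)
        then show ?thesis
          using 2 e(1) sb by (simp add: mult_le_0_iff)
      qed
    qed
    then have "y = a' + (\<Sum>b\<in>B'. s b *\<^sub>R b)"
      unfolding s(1) a'_def split by (simp add: add.assoc)
    then show "y \<in> parallelepiped a' B'"
      using s(2) B' unfolding parallelepiped_def by auto
  qed
  moreover have "parallelepiped a' B' \<subseteq> F"
  proof
    fix y assume "y \<in> parallelepiped a' B'"
    then obtain s0 where s0: "y = a' + (\<Sum>b\<in>B'. s0 b *\<^sub>R b)" "\<forall>b\<in>B'. 0 \<le> s0 b \<and> s0 b \<le> 1"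
      unfolding parallelepiped_def by auto
    define s where "s b = (if b \<in> B' then s0 b else t b)" for b
    have s: "y = a + (\<Sum>b\<in>B. s b *\<^sub>R b)" "\<forall>b\<in>B. 0 \<le> s b \<and> s b \<le> 1"
      using s0 t(2) unfolding split a'_def by (auto simp: s_def add.assoc)
    \<comment> \<open>The least distance of a free coordinate of \<open>x\<close> from 0 and 1; the
      inserted 1 covers empty \<open>B'\<close>. Coordinates of \<open>x\<close> and
      \<open>y\<close> differ by at most 1, so a step of \<epsilon> times the difference stays in
      the cube of coefficients.\<close>
    define \<epsilon> where "\<epsilon> = Min (insert 1 ((\<lambda>b. min (t b) (1 - t b)) ` B'))"
    have \<epsilon>: "\<epsilon> > 0" "\<And>b. b \<in> B' \<Longrightarrow> \<epsilon> \<le> t b \<and> \<epsilon> \<le> 1 - t b"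
      using B'(2) by (auto simp: \<epsilon>_def B'_def Min_le_iff)
    \<comment> \<open>\<open>z\<close> lies beyond \<open>x\<close> as seen from \<open>y\<close>.
      Since \<open>x\<close> is in \<open>F\<close> and strictly between \<open>y\<close> and
      \<open>z\<close>, the face property puts \<open>y\<close> in \<open>F\<close>.\<close>
    define z where "z = x + \<epsilon> *\<^sub>R (x - y)"
    have z: "z = a + (\<Sum>b\<in>B. (t b + \<epsilon> * (t b - s b)) *\<^sub>R b)"
      unfolding z_def t(1) s(1)
      by (simp add: algebra_simps sum.distrib scaleR_sum_right sum_subtractf)
    have "0 \<le> t b + \<epsilon> * (t b - s b) \<and> t b + \<epsilon> * (t b - s b) \<le> 1" if "b \<in> B" for b
    proof (cases "b \<in> B'")
      case True
      have "\<bar>t b - s b\<bar> \<le> 1"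
        using t(2) s(2) that by (smt (verit))
      then have "\<bar>\<epsilon> * (t b - s b)\<bar> \<le> \<epsilon>"
        using \<epsilon>(1) by (simp add: abs_mult mult_left_le)
      then show ?thesis
        using \<epsilon>(2)[OF True] by linarith
    next
      case False
      then show ?thesis
        using t(2) that by (simp add: s_def)
    qed
    then have zP: "z \<in> parallelepiped a B"
      unfolding z parallelepiped_def by auto
    have yP: "y \<in> parallelepiped a B"
      using s unfolding parallelepiped_def by auto
    show "y \<in> F"
    proof (cases "y = x")
      case False
      have "x = (1 - 1 / (1 + \<epsilon>)) *\<^sub>R y + (1 / (1 + \<epsilon>)) *\<^sub>R z"
      proof -
        have "(1 + \<epsilon>) *\<^sub>R x = \<epsilon> *\<^sub>R y + z"
          by (simp add: z_def algebra_simps)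
        then have "(1 / (1 + \<epsilon>)) *\<^sub>R ((1 + \<epsilon>) *\<^sub>R x) = (1 / (1 + \<epsilon>)) *\<^sub>R (\<epsilon> *\<^sub>R y + z)"
          by simp
        moreover have "1 - 1 / (1 + \<epsilon>) = (1 / (1 + \<epsilon>)) * \<epsilon>"
          using \<epsilon>(1) by (simp add: field_simps)
        ultimately show ?thesis
          using \<epsilon>(1) by (simp add: scaleR_add_right)
      qed
      moreover have "y \<noteq> z"
      proof
        assume "y = z"
        then have "(1 + \<epsilon>) *\<^sub>R (x - y) = 0"
          by (simp add: z_def algebra_simps)
        then show False
          using \<epsilon>(1) False by simp
      qed
      ultimately have "x \<in> open_segment y z"
        using \<epsilon>(1) unfolding in_segment by (intro conjI exI[of _ "1 / (1 + \<epsilon>)"]) auto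
      then show ?thesis
        using assms(3) xF yP zP unfolding face_of_def by blast
    qed (use xF in simp)
  qed
  ultimately show ?thesis
    using B' by blast
qed

section \<open>Edge vectors with constant Gram matrix\<close>

text \<open>The reflection in the hyperplane orthogonal to \<open>u - v\<close> fixes every other
  edge, whose inner products with \<open>u\<close> and \<open>v\<close> are both \<open>d\<close>,
  and exchanges \<open>u\<close> and \<open>v\<close> because their norms agree.\<close>

lemma congruent_parallelepipeds:
  fixes B :: "'a::euclidean_space set"
  assumes gram: "\<And>u v. u \<in> B \<Longrightarrow> v \<in> B \<Longrightarrow> u \<bullet> v = (if u = v then c else d)"
    and uv: "u \<in> B" "v \<in> B"
  shows "congruent_sets (parallelepiped a (B - {u})) (parallelepiped a' (B - {v}))"
proof -
  define w where "w = u - v"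
  \<comment> \<open>For \<open>u = v\<close> the division by zero gives 0, so \<open>R\<close> is
    then the identity.\<close>
  define R where "R x = x - (2 * (x \<bullet> w) / (w \<bullet> w)) *\<^sub>R w" for x
  have "linear R"
    unfolding R_def by (intro linearI) (auto simp: algebra_simps add_divide_distrib inner_add_left)
  have "R x \<bullet> R x = x \<bullet> x" for x
    by (cases "w = 0") (auto simp: R_def algebra_simps inner_commute power2_eq_square)
  then have norm_R: "norm (R x) = norm x" for x
    by (simp add: norm_eq_sqrt_inner)
  have dist_R: "dist (R x) (R y) = dist x y" for x y
    using norm_R[of "x - y"] by (simp add: dist_norm linear_diff[OF \<open>linear R\<close>])
  then have "inj R"
    by (metis dist_eq_0_iff injI)
  have fixed: "R b = b" if "b \<in> B - {u}" "b \<noteq> v" for b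
    using that uv gram by (simp add: R_def w_def inner_diff_right)
  have swap: "R v = u"
  proof (cases "u = v")
    case False
    have "u \<bullet> u = c" "v \<bullet> v = c" "u \<bullet> v = d" "v \<bullet> u = d"
      using False uv gram by auto
    then have "w \<bullet> w = 2 * (c - d)" "v \<bullet> w = d - c"
      by (auto simp: w_def inner_diff_left inner_diff_right)
    moreover have "w \<bullet> w \<noteq> 0"
      using False by (simp add: w_def)
    ultimately have "2 * (v \<bullet> w) / (w \<bullet> w) = - 1"
      by (simp add: field_simps)
    then show ?thesis
      by (simp add: R_def w_def)
  qed (simp add: R_def w_def)
  have image_R: "R ` (B - {u}) = B - {v}"
  proof (cases "u = v")
    case True
    then show ?thesis
      using fixed by force
  next
    case False
    then have "B - {u} = insert v (B - {u, v})"
      using uv by auto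
    moreover have "R ` (B - {u, v}) = B - {u, v}"
      using fixed by force
    ultimately show ?thesis
      using swap uv False by auto
  qed
  have "R ` parallelepiped a (B - {u}) = parallelepiped (R a) (B - {v})"
    using linear_image_parallelepiped[OF \<open>linear R\<close>] \<open>inj R\<close> image_R
    by (metis inj_on_subset subset_UNIV)
  \<comment> \<open>The base points are arbitrary; a translation after \<open>R\<close> aligns
    them.\<close>
  then have "(\<lambda>x. (a' - R a) + R x) ` parallelepiped a (B - {u}) = parallelepiped a' (B - {v})"
    using translation_parallelepiped[of "a' - R a" "R a" "B - {v}"]
    by (simp add: image_image[symmetric])
  then show ?thesis
    unfolding congruent_sets_def using dist_R by (intro exI[of _ "\<lambda>x. (a' - R a) + R x"]) auto
qed

text \<open>The Gram condition passes to subsets of \<open>B\<close>, so strong induction reaches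
  the facets. Its diagonal gives the equal sides of the rhombus; the whole condition gives the
  congruence of facets.\<close>

lemma hyper_rhombus_parallelepiped:
  fixes B :: "'a::euclidean_space set"
  assumes "finite B" "independent B" "card B = m" "m \<ge> 2"
    and "\<And>u v. u \<in> B \<Longrightarrow> v \<in> B \<Longrightarrow> u \<bullet> v = (if u = v then c else d)"
  shows "hyper_rhombus m (parallelepiped a B)"
  using assms
proof (induction m arbitrary: a B rule: less_induct)
  case (less m)
  show ?case
  proof (cases "m = 2")
    case True
    then obtain u v where uv: "B = {u, v}" "u \<noteq> v"
      using less.prems(3) card_2_iff by metis
    have "norm u = norm v"
      using less.prems(5)[of u u] less.prems(5)[of v v] uv by (simp add: norm_eq_sqrt_inner)
    then have "is_rhombus (parallelepiped a B)"
      unfolding is_rhombus_def using uv less.prems(2) by blast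
    then show ?thesis
      using True hyper_rhombus.rhombus by blast
  next
    case False
    then have m: "m \<ge> 3"
      using less.prems(4) by linarith
    \<comment> \<open>Counting dimensions, a facet omits exactly one edge.\<close>
    have facet: "\<exists>a' b. b \<in> B \<and> F = parallelepiped a' (B - {b})"
      if F: "F face_of parallelepiped a B" "aff_dim F = int m - 1" for F
    proof -
      have "F \<noteq> {}"
        using F(2) m by auto
      then obtain a' B' where B': "B' \<subseteq> B" "F = parallelepiped a' B'"
        using face_of_parallelepiped less.prems(1,2) F(1) by metis
      have "finite B'" "independent B'"
        using B' less.prems(1,2) finite_subset independent_mono by blast+
      then have "int (card B') = int m - 1"
        using aff_dim_parallelepiped[of B' a'] F(2) B'(2) by simp
      then have "card (B - B') = 1"
        using B' less.prems(1,3) \<open>finite B'\<close> by (simp add: card_Diff_subset)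
      then obtain b where "B - B' = {b}"
        using card_1_singletonE by blast
      then have "b \<in> B" "B' = B - {b}"
        using B'(1) by auto
      then show ?thesis
        using B'(2) by blast
    qed
    show ?thesis
    proof (rule hyper_rhombus.step[OF m])
      show "is_parallelepiped m (parallelepiped a B)"
        unfolding is_parallelepiped_def using less.prems(1-3) by blast
    next
      fix F assume "F face_of parallelepiped a B" "aff_dim F = int m - 1"
      then obtain a' b where b: "b \<in> B" "F = parallelepiped a' (B - {b})"
        using facet by blast
      show "hyper_rhombus (m - 1) F"
        unfolding b(2)
      proof (rule less.IH)
        show "independent (B - {b})"
          using less.prems(2) independent_mono by blast
      qed (use b m less.prems in auto)
    next
      fix F G
      assume "F face_of parallelepiped a B" "aff_dim F = int m - 1"
        and "G face_of parallelepiped a B" "aff_dim G = int m - 1"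
      then obtain a1 b1 a2 b2 where
        "b1 \<in> B" "F = parallelepiped a1 (B - {b1})" "b2 \<in> B" "G = parallelepiped a2 (B - {b2})"
        using facet by metis
      then show "congruent_sets F G"
        using congruent_parallelepipeds less.prems(5) by blast
    qed
  qed
qed

section \<open>The Voronoi cell as a projected cube\<close>

text \<open>The orthogonal projection \<pi>; \<open>CARD('d)\<close> enters as the squared norm of
  \<open>1\<close>.\<close>

definition sum_zero_proj :: "real ^ 'd \<Rightarrow> real ^ 'd" where
  "sum_zero_proj x = x - ((x \<bullet> 1) / real CARD('d)) *\<^sub>R 1"

lemma inner_one_one: "(1 :: real ^ 'd) \<bullet> 1 = real CARD('d)"
  by (simp add: inner_vec_def)

lemma linear_sum_zero_proj: "linear sum_zero_proj"
  unfolding sum_zero_proj_def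
  by (intro linearI) (auto simp: algebra_simps add_divide_distrib inner_add_left)

lemma inner_sum_zero_proj:
  fixes x y :: "real ^ 'd"
  shows "sum_zero_proj x \<bullet> sum_zero_proj y = x \<bullet> y - (x \<bullet> 1) * (y \<bullet> 1) / real CARD('d)"
  by (simp add: sum_zero_proj_def inner_diff_left inner_diff_right inner_one_one inner_commute)

lemma inner_Basis_one:
  fixes b :: "real ^ 'd"
  assumes "b \<in> Basis"
  shows "b \<bullet> 1 = 1"
  using assms by (auto simp: Basis_vec_def inner_axis')

lemma sum_zero_proj_in_hyperplane: "sum_zero_proj x \<in> sum_zero_hyperplane"
  by (simp add: sum_zero_proj_def sum_zero_hyperplane_def inner_diff_left inner_one_one)

lemma parallelepiped_Basis:
  "parallelepiped 0 (Basis :: (real ^ 'd) set) = {x. \<forall>i. 0 \<le> x $ i \<and> x $ i \<le> 1}"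
proof -
  have "parallelepiped 0 (Basis :: (real ^ 'd) set) = {x. \<forall>b\<in>Basis. 0 \<le> x \<bullet> b \<and> x \<bullet> b \<le> 1}"
  proof safe
    fix x :: "real ^ 'd" assume "\<forall>b\<in>Basis. 0 \<le> x \<bullet> b \<and> x \<bullet> b \<le> 1"
    then show "x \<in> parallelepiped 0 Basis"
      unfolding parallelepiped_def
      by (intro CollectI exI[of _ "\<lambda>b. x \<bullet> b"]) (auto simp: euclidean_representation)
  qed (auto simp: parallelepiped_def)
  then show ?thesis
    by (auto simp: Basis_vec_def inner_axis)
qed

text \<open>It suffices to test the lattice vector \<open>q = axis i 1 - axis j 1\<close> of squared
  length 2: the cell inequality amounts to
  \<open>2 * (x \<bullet> q) \<le> q \<bullet> q\<close>.\<close>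

lemma voronoi_cell_A_coords_diff_le_1:
  fixes x :: "real ^ 'd"
  assumes "x \<in> voronoi_cell_A"
  shows "x $ i - x $ j \<le> 1"
proof (cases "i = j")
  case False
  define q :: "real ^ 'd" where "q = axis i 1 - axis j 1"
  have "q \<in> lattice_A"
    unfolding lattice_A_def sum_zero_hyperplane_def
    by (auto simp: q_def inner_diff_left inner_axis') (auto simp: axis_def)
  then have "norm x \<le> norm (x - q)"
    using assms by (auto simp: voronoi_cell_A_def)
  then have "x \<bullet> x \<le> (x - q) \<bullet> (x - q)"
    by (simp add: norm_le)
  then have "2 * (x \<bullet> q) \<le> q \<bullet> q"
    by (simp add: inner_diff_left inner_diff_right inner_commute)
  moreover have "q \<bullet> q = 2"
    using False by (simp add: q_def inner_diff_left inner_diff_right inner_axis_axis)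
  moreover have "x \<bullet> q = x $ i - x $ j"
    by (simp add: q_def inner_diff_right inner_axis)
  ultimately show ?thesis
    by simp
qed simp

text \<open>Points of the cell lift to the cube by a shift along \<open>1\<close>, which the
  projection kills. Conversely, integrality of \<open>q\<close> yields the cell inequality
  coordinate by coordinate.\<close>

lemma voronoi_cell_A_eq_proj_cube:
  "(voronoi_cell_A :: (real ^ 'd) set) = sum_zero_proj ` parallelepiped 0 Basis"
proof safe
  fix x :: "real ^ 'd" assume x: "x \<in> voronoi_cell_A"
  \<comment> \<open>Subtracting the least coordinate makes all coordinates nonnegative; the bound on
    differences keeps them at most 1.\<close>
  define m where "m = Min (range (($) x))"
  define y where "y = x - m *\<^sub>R 1"
  have "m \<in> range (($) x)"
    unfolding m_def by (rule Min_in) auto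
  then obtain j where j: "m = x $ j"
    by blast
  have "m \<le> x $ i" for i
    by (simp add: m_def)
  then have "y \<in> parallelepiped 0 Basis"
    using voronoi_cell_A_coords_diff_le_1[OF x, of _ j]
    by (auto simp: parallelepiped_Basis y_def j algebra_simps)
  moreover have "x \<bullet> 1 = 0"
    using x by (simp add: voronoi_cell_A_def sum_zero_hyperplane_def)
  then have "sum_zero_proj y = x"
    by (simp add: y_def sum_zero_proj_def inner_diff_left inner_one_one)
  ultimately show "x \<in> sum_zero_proj ` parallelepiped 0 Basis"
    by blast
next
  fix y :: "real ^ 'd" assume "y \<in> parallelepiped 0 Basis"
  then have y: "\<forall>i. 0 \<le> y $ i \<and> y $ i \<le> 1"
    by (simp add: parallelepiped_Basis)
  define x where "x = sum_zero_proj y"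
  have "norm x \<le> norm (x - q)" if "q \<in> lattice_A" for q
  proof -
    have q: "q \<bullet> 1 = 0" "\<forall>i. q $ i \<in> \<int>"
      using that by (auto simp: lattice_A_def sum_zero_hyperplane_def)
    \<comment> \<open>The extra \<open>q $ i\<close> sums to 0 over all \<open>i\<close>, yet makes
      each term nonnegative: for integral \<open>q $ i\<close> the factors \<open>q $ i\<close> and
      \<open>q $ i - 2 * y $ i + 1\<close> never have opposite signs.\<close>
    have "0 \<le> q $ i * q $ i - 2 * (q $ i * y $ i) + q $ i" for i
    proof -
      obtain k :: int where k: "q $ i = of_int k"
        using q(2) Ints_cases by metis
      have y': "0 \<le> y $ i" "y $ i \<le> 1"
        using y by auto
      consider "1 \<le> k" | "k = 0" | "k \<le> -1"
        by linarith
      then have "0 \<le> q $ i * (q $ i - 2 * y $ i + 1)"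
      proof cases
        case 1
        then have "1 \<le> q $ i"
          using k by simp
        then show ?thesis
          using y' by (intro mult_nonneg_nonneg) linarith+
      next
        case 3
        then have "q $ i \<le> -1"
          using k of_int_le_iff[of k "-1", where 'a = real] by simp
        then show ?thesis
          using y' by (intro mult_nonpos_nonpos) linarith+
      qed (simp add: k)
      then show ?thesis
        by (simp add: algebra_simps)
    qed
    then have "0 \<le> (\<Sum>i\<in>UNIV. q $ i * q $ i - 2 * (q $ i * y $ i) + q $ i)"
      by (intro sum_nonneg) auto
    also have "\<dots> = q \<bullet> q - 2 * (q \<bullet> y) + q \<bullet> 1"
      by (simp add: inner_vec_def sum.distrib sum_subtractf sum_distrib_left)
    \<comment> \<open>\<open>y\<close> and \<open>x\<close> differ by a multiple of
      \<open>1\<close>, to which \<open>q\<close> is orthogonal.\<close>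
    also have "q \<bullet> y = q \<bullet> x"
      using q(1) by (simp add: x_def sum_zero_proj_def inner_diff_right)
    finally have "x \<bullet> x \<le> (x - q) \<bullet> (x - q)"
      using q(1) by (simp add: inner_diff_left inner_diff_right inner_commute)
    then show ?thesis
      by (simp add: norm_le)
  qed
  then show "sum_zero_proj y \<in> voronoi_cell_A"
    using sum_zero_proj_in_hyperplane[of y] by (auto simp: voronoi_cell_A_def x_def)
qed

section \<open>Lifting faces of the cell to faces of the cube\<close>

text \<open>The kernel consists of multiples of \<open>1\<close>, which has component 1 along every
  basis vector, whereas \<open>span B\<close> has component 0 along any basis vector missing from
  \<open>B\<close>.\<close>

lemma inj_on_span_sum_zero_proj:
  fixes B :: "(real ^ 'd) set"
  assumes "B \<subset> Basis"
  shows "inj_on sum_zero_proj (span B)"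
proof -
  obtain e where e: "e \<in> Basis" "e \<notin> B"
    using assms by blast
  have "x = 0" if x: "x \<in> span B" "sum_zero_proj x = 0" for x
  proof -
    have "x \<bullet> e = 0"
      using x(1)
    proof (induction rule: span_induct_alt)
      case (step c b y)
      then have "b \<bullet> e = 0"
        using assms e by (auto intro: inner_not_same_Basis)
      then show ?case
        using step by (simp add: inner_add_left)
    qed simp
    have x_eq: "x = ((x \<bullet> 1) / real CARD('d)) *\<^sub>R 1"
      using x(2) by (simp add: sum_zero_proj_def)
    then have "x \<bullet> e = (x \<bullet> 1) / real CARD('d) * (1 \<bullet> e)"
      by (metis inner_scaleR_left)
    then have "(x \<bullet> 1) / real CARD('d) = 0"
      using \<open>x \<bullet> e = 0\<close> inner_Basis_one[OF e(1)] by (simp add: inner_commute)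
    then show ?thesis
      using x_eq by simp
  qed
  then show ?thesis
    using linear_injective_on_subspace_0[OF linear_sum_zero_proj subspace_span, of B] by blast
qed

text \<open>A linear map sends an open segment to an open segment, where the face property of
  \<open>F\<close> applies, or to a single point, where the endpoints share the image of
  \<open>y\<close>.\<close>

lemma face_of_linear_vimage:
  assumes "linear f" "F face_of f ` S" "convex S"
  shows "{y \<in> S. f y \<in> F} face_of S"
proof -
  interpret linear f by fact
  have "convex {y \<in> S. f y \<in> F}"
    using convex_Int[OF assms(3) convex_linear_vimage[OF assms(1) face_of_imp_convex[OF assms(2)]]]
    by (simp add: vimage_def Int_def)
  moreover have "f p \<in> F \<and> f q \<in> F"
    if pqy: "p \<in> S" "q \<in> S" "y \<in> S" "f y \<in> F" "y \<in> open_segment p q" for p q y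
  proof -
    obtain u where u: "0 < u" "u < 1" "y = (1 - u) *\<^sub>R p + u *\<^sub>R q"
      using pqy(5) by (auto simp: in_segment)
    then have fy: "f y = (1 - u) *\<^sub>R f p + u *\<^sub>R f q"
      by (simp add: add scale)
    show ?thesis
    proof (cases "f p = f q")
      case True
      then have "f y = f p"
        using fy by (simp add: algebra_simps)
      then show ?thesis
        using True pqy(4) by simp
    next
      case False
      then have "f y \<in> open_segment (f p) (f q)"
        using u fy by (auto simp: in_segment)
      then show ?thesis
        using assms(2) pqy unfolding face_of_def by blast
    qed
  qed
  ultimately show ?thesis
    unfolding face_of_def by blast
qed

theorem lemma6:
  fixes n k :: nat and F :: "(real ^ 'd) set"
  assumes "CARD('d) = n + 1"
    and "2 \<le> k" and "k \<le> n - 1"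
    and "F face_of (voronoi_cell_A :: (real ^ 'd) set)"
    and "aff_dim F = int k"
  shows "hyper_rhombus k F"
proof -
  let ?C = "parallelepiped 0 (Basis :: (real ^ 'd) set)"
  let ?G = "{y \<in> ?C. sum_zero_proj y \<in> F}"
  have proj_indep: "finite (sum_zero_proj ` B) \<and> independent (sum_zero_proj ` B) \<and>
      card (sum_zero_proj ` B) = card B \<and> inj_on sum_zero_proj B"
    if "B \<subset> Basis" for B :: "(real ^ 'd) set"
  proof -
    have "finite B" "independent B"
      using that finite_subset[of B Basis] independent_mono[OF independent_Basis, of B] by auto
    moreover have "inj_on sum_zero_proj B"
      using inj_on_span_sum_zero_proj[OF that] inj_on_subset span_superset by blast
    moreover have "independent (sum_zero_proj ` B)"
      using linear_independent_injective_image[OF linear_sum_zero_proj \<open>independent B\<close>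
          inj_on_span_sum_zero_proj[OF that]] .
    ultimately show ?thesis
      by (simp add: card_image)
  qed
  have "convex ?C"
    unfolding parallelepiped_Basis
    by (auto simp: convex_def intro!: convex_bound_le add_nonneg_nonneg)
  have FV: "F face_of sum_zero_proj ` ?C"
    using assms(4) unfolding voronoi_cell_A_eq_proj_cube .
  have "?G face_of ?C"
    using face_of_linear_vimage[OF linear_sum_zero_proj FV \<open>convex ?C\<close>] .
  have FG: "F = sum_zero_proj ` ?G"
    using face_of_imp_subset[OF FV] by blast
  have "?G \<noteq> {}"
    using FG assms(5) by force
  then obtain a B where B: "B \<subseteq> Basis" "?G = parallelepiped a B"
    using face_of_parallelepiped[OF finite_Basis independent_Basis \<open>?G face_of ?C\<close>] by metis
  \<comment> \<open>If the lifted face were the whole cube, \<open>F\<close> would contain the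
    projection of an \<open>n\<close>-dimensional subcube, on whose edges the projection is
    injective, contrary to \<open>k \<le> n - 1\<close>.\<close>
  have proper: "B \<noteq> Basis"
  proof
    assume "B = Basis"
    obtain e :: "real ^ 'd" where e: "e \<in> Basis"
      using nonempty_Basis by blast
    let ?B = "Basis - {e}"
    have sub: "?B \<subset> Basis"
      using e by blast
    have "parallelepiped (sum_zero_proj a) (sum_zero_proj ` ?B) = sum_zero_proj ` parallelepiped a ?B"
      using linear_image_parallelepiped[OF linear_sum_zero_proj] proj_indep[OF sub] by blast
    also have "\<dots> \<subseteq> F"
      using FG B(2) \<open>B = Basis\<close> parallelepiped_mono[of Basis ?B a] by auto
    finally have "aff_dim (parallelepiped (sum_zero_proj a) (sum_zero_proj ` ?B)) \<le> int k"
      using aff_dim_subset assms(5) by metis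
    then have "card ?B \<le> k"
      using aff_dim_parallelepiped proj_indep[OF sub] by (metis of_nat_le_iff)
    moreover have "card ?B = n"
      using e assms(1) by simp
    \<comment> \<open>\<open>2 \<le> k\<close> rules out \<open>n = 0\<close>, where the subtraction
      in \<open>n - 1\<close> truncates.\<close>
    ultimately show False
      using assms(2,3) by linarith
  qed
  let ?P = "sum_zero_proj ` B"
  have P: "finite ?P" "independent ?P" "inj_on sum_zero_proj B"
    using proj_indep B(1) proper by auto
  have F: "F = parallelepiped (sum_zero_proj a) ?P"
    using FG B(2) linear_image_parallelepiped[OF linear_sum_zero_proj P(3)] by simp
  then have "card ?P = k"
    using aff_dim_parallelepiped[OF P(1,2)] assms(5) by simp
  \<comment> \<open>Orthonormal basis vectors each have inner product 1 with \<open>1\<close>, so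
    projecting lowers every entry of their Gram matrix by \<open>1 / real CARD('d)\<close>.\<close>
  moreover have "u \<bullet> v = (if u = v then 1 - 1 / real CARD('d) else - 1 / real CARD('d))"
    if uv: "u \<in> ?P" "v \<in> ?P" for u v
  proof -
    obtain x y where xy: "x \<in> B" "y \<in> B" "u = sum_zero_proj x" "v = sum_zero_proj y"
      using uv by blast
    then have "u = v \<longleftrightarrow> x = y"
      using P(3) by (auto dest: inj_onD)
    moreover have "x \<in> Basis" "y \<in> Basis"
      using xy B(1) by auto
    ultimately show ?thesis
      using xy by (simp add: inner_sum_zero_proj inner_Basis_one inner_Basis)
  qed
  ultimately show ?thesis
    unfolding F using hyper_rhombus_parallelepiped[OF P(1,2)] assms(2) by blast
qed

end
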